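(* Let $A$ be a non-singular linear transformation of $\mathbb R^4$. Then for any $X=x_0e_0+x\in\mathbb R^4$ (with $x\in\mathbb R^3$), $$\det(A)\,\mathcal F(AX)=\wedge^3(\wedge^2A)\,\mathcal F(X),$$ and $$\det(A^{-T})\,\mathcal F'(A^{-T}X)=\wedge^3\bigl(\mathcal J\circ(\wedge^2A^{-T})\circ\mathcal J\bigr)\,\mathcal F'(X).$$
   Context: Let $e_0,e_1,e_2,e_3$ be the standard orthonormal basis of $\mathbb R^4$ and identify $\mathbb R^3=\mathrm{span}(e_1,e_2,e_3)$. $\mathbb R^{3,3}=\Lambda^2(\mathbb R^4)$ has basis $E_i=e_0\wedge e_i$ ($i=1,2,3$), $E_1'=e_2\wedge e_3$, $E_2'=e_3\wedge e_1$, $E_3'=e_1\wedge e_2$ and symmetric bilinear form $E_i\cdot E_j'=\delta_{ij}$, $E_i\cdot E_j=E_i'\cdot E_j'=0$. For $x\in\mathbb R^3$, $E(x)=\sum x_iE_i=e_0\wedge x$ and $E'(x)=\sum x_iE_i'$. $\mathcal J$ is the linear map of $\mathbb R^{3,3}$ interchanging $E_i$ and $E_i'$. In $\Lambda(\mathbb R^{3,3})$ (outer product $\wedge$ over $\mathbb R^{3,3}$) put $I_3=E_1\wedge E_2\wedge E_3$, $J_3=E_1'\wedge E_2'\wedge E_3'$, $K_2=\sum_iE_i\wedge E_i'$; for a vector $a$, $a\cdot(b_1\wedge b_2\wedge b_3)=(a\cdot b_1)b_2\wedge b_3-(a\cdot b_2)b_1\wedge b_3+(a\cdot b_3)b_1\wedge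 b_2$. The Plücker representations of points and planes are $$\mathcal F(x_0e_0+x)=E(x)\wedge(E(x)\cdot J_3)-x_0E(x)\wedge K_2+x_0^2I_3,$$ $$\mathcal F'(de_0+n)=E'(n)\wedge(E'(n)\cdot I_3)+d\,E'(n)\wedge K_2+d^2J_3 .$$ $\wedge^2A$ is the induced map on $\Lambda^2(\mathbb R^4)=\mathbb R^{3,3}$, $(\wedge^2A)(a\wedge b)=Aa\wedge Ab$; for a linear map $B$ of $\mathbb R^{3,3}$, $\wedge^3B$ is the induced map on $\Lambda^3(\mathbb R^{3,3})$. *)

theory Defs
  imports "HOL-Analysis.Analysis" "HOL-Library.Poly_Mapping"
begin

section \<open>The exterior algebra of a real vector space\<close>

text \<open>
  The exterior algebra of \<open>V\<close> is the tensor algebra of \<open>V\<close> modulo the two-sided ideal generated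
  by the squares \<open>v \<otimes> v\<close>.  The tensor algebra is in turn obtained from the free algebra over the
  underlying set of \<open>V\<close> (finitely supported real functions on words, with convolution) by
  imposing linearity, so all three kinds of relations are put into one ideal.
\<close>

datatype 'a ext_word = Word (letters: "'a list")

instantiation ext_word :: (type) monoid_add
begin
definition zero_ext_word :: "'a ext_word" where "0 = Word []"
definition plus_ext_word :: "'a ext_word \<Rightarrow> 'a ext_word \<Rightarrow> 'a ext_word"
  where "u + v = Word (letters u @ letters v)"
instance by standard (simp_all add: zero_ext_word_def plus_ext_word_def)
end

type_synonym 'a free_alg = "'a ext_word \<Rightarrow>\<^sub>0 real"

definition letter :: "'a \<Rightarrow> 'a free_alg" where "letter v = Poly_Mapping.single (Word [v]) 1"
definition const :: "real \<Rightarrow> 'a free_alg" where "const c = Poly_Mapping.single 0 c"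

inductive_set ext_ideal :: "'a::real_vector free_alg set" where
  add_rel: "letter (u + v) - letter u - letter v \<in> ext_ideal"
| scale_rel: "letter (c *\<^sub>R v) - const c * letter v \<in> ext_ideal"
| square_rel: "letter v * letter v \<in> ext_ideal"
| add: "p \<in> ext_ideal \<Longrightarrow> q \<in> ext_ideal \<Longrightarrow> p + q \<in> ext_ideal"
| mult_left: "p \<in> ext_ideal \<Longrightarrow> r * p \<in> ext_ideal"
| mult_right: "p \<in> ext_ideal \<Longrightarrow> p * r \<in> ext_ideal"

lemma ext_ideal_zero: "0 \<in> ext_ideal"
  using ext_ideal.mult_left[OF ext_ideal.square_rel, of 0] by simp

lemma ext_ideal_uminus: "p \<in> ext_ideal \<Longrightarrow> - p \<in> ext_ideal"
  using ext_ideal.mult_left[of p "-1"] by simp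

definition ext_rel :: "'a::real_vector free_alg \<Rightarrow> 'a free_alg \<Rightarrow> bool"
  where "ext_rel p q \<longleftrightarrow> p - q \<in> ext_ideal"

lemma equivp_ext_rel: "equivp (ext_rel :: 'a::real_vector free_alg \<Rightarrow> _)" (is "equivp ?R")
proof (rule equivpI)
  show "reflp ?R" by (simp add: reflp_def ext_rel_def ext_ideal_zero)
  show "symp ?R"
    unfolding symp_def ext_rel_def by (metis ext_ideal_uminus minus_diff_eq)
  show "transp ?R"
  proof (rule transpI)
    fix p q r :: "'a free_alg"
    assume "ext_rel p q" "ext_rel q r"
    then have "(p - q) + (q - r) \<in> ext_ideal" unfolding ext_rel_def by (rule ext_ideal.add)
    then show "ext_rel p r" by (simp add: ext_rel_def)
  qed
qed

quotient_type (overloaded) 'a ext = "'a::real_vector free_alg" / ext_rel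
  by (rule equivp_ext_rel)

lemma single_induct [case_names single add]:
  assumes "\<And>w c. P (Poly_Mapping.single w (c::real))" and "\<And>p q. P p \<Longrightarrow> P q \<Longrightarrow> P (p + q)"
  shows "P p"
proof (induction p rule: update_induct)
  case const
  then show ?case using assms(1)[of undefined 0] by simp
next
  case (update f a b)
  have "Poly_Mapping.update a b f = Poly_Mapping.single a b + f"
    using update(1) by (intro poly_mapping_eqI)
      (auto simp: lookup_update lookup_add lookup_single when_def in_keys_iff)
  then show ?case using assms update by metis
qed

lemma const_add: "const (a + b) = const a + const b"
  by (simp add: const_def single_add)

lemma const_mult: "const (a * b) = const a * const b"
  by (simp add: const_def mult_single)

lemma const_one: "const 1 = 1"
  by (simp add: const_def)

lemma const_central: "p * const c = const c * p"
  by (induction p rule: single_induct) (simp_all add: const_def mult_single mult.commute algebra_simps)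

text \<open>
  A linear action of the letters on a vector space in which every letter squares to zero
  extends uniquely to an action of the exterior algebra.  Algebra homomorphisms and contractions are
  both obtained in this way.
\<close>

definition free_act :: "('a \<Rightarrow> 'm \<Rightarrow> 'm) \<Rightarrow> 'a free_alg \<Rightarrow> 'm \<Rightarrow> 'm::real_vector"
  where "free_act s p m = (\<Sum>w\<in>Poly_Mapping.keys p. Poly_Mapping.lookup p w *\<^sub>R foldr s (letters w) m)"

definition ext_action :: "('a::real_vector \<Rightarrow> 'm \<Rightarrow> 'm::real_vector) \<Rightarrow> bool"
  where "ext_action s \<longleftrightarrow> bilinear s \<and> (\<forall>v m. s v (s v m) = 0)"

lemma free_act_superset:
  assumes "finite S" "Poly_Mapping.keys p \<subseteq> S"
  shows "free_act s p m = (\<Sum>w\<in>S. Poly_Mapping.lookup p w *\<^sub>R foldr s (letters w) m)"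
  unfolding free_act_def using assms
  by (intro sum.mono_neutral_left) (auto simp: in_keys_iff)

lemma free_act_add: "free_act s (p + q) m = free_act s p m + free_act s q m"
proof -
  let ?S = "Poly_Mapping.keys p \<union> Poly_Mapping.keys q"
  have "free_act s r m = (\<Sum>w\<in>?S. Poly_Mapping.lookup r w *\<^sub>R foldr s (letters w) m)"
    if "r \<in> {p, q, p + q}" for r
    using that keys_add[of p q] by (intro free_act_superset) auto
  then show ?thesis by (simp add: lookup_add scaleR_add_left sum.distrib)
qed

lemma free_act_single:
  "free_act s (Poly_Mapping.single w c) m = c *\<^sub>R foldr s (letters w) m"
  by (subst free_act_superset[of "{w}"]) auto

lemma free_act_zero [simp]: "free_act s 0 m = 0"
  by (simp add: free_act_def)

lemma free_act_diff: "free_act s (p - q) m = free_act s p m - free_act s q m"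
  using free_act_add[of s "p - q" q m] by simp

lemma free_act_const: "free_act s (const c) m = c *\<^sub>R m"
  by (simp add: const_def free_act_single zero_ext_word_def)

lemma free_act_letter: "free_act s (letter v) m = s v m"
  by (simp add: letter_def free_act_single)

lemma linear_foldr: "(\<And>v. linear (s v)) \<Longrightarrow> linear (foldr s vs)"
  by (induction vs) (auto simp: id_def o_def linear_compose[unfolded o_def] linear_id[unfolded id_def])

lemma free_act_linear:
  assumes "\<And>v. linear (s v)"
  shows "linear (free_act s p)"
proof -
  have "linear (foldr s vs)" for vs using assms by (rule linear_foldr)
  then show ?thesis unfolding free_act_def
    by (intro linear_compose_sum ballI linear_compose_scale_right) auto
qed

lemma free_act_mult:
  assumes "\<And>v. linear (s v)"
  shows "free_act s (p * q) m = free_act s p (free_act s q m)"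
proof (induction p rule: single_induct)
  case (single w c)
  show ?case
  proof (induction q rule: single_induct)
    case (single w' c')
    have "linear (foldr s (letters w))" using assms by (rule linear_foldr)
    then show ?case by (simp add: mult_single free_act_single plus_ext_word_def linear_scale)
  next
    case (add p q)
    then show ?case
      by (simp add: distrib_left free_act_add linear_add[OF free_act_linear[OF assms]])
  qed
next
  case (add p q)
  then show ?case by (simp add: distrib_right free_act_add)
qed

lemma free_act_ideal:
  assumes "ext_action s" "p \<in> ext_ideal"
  shows "free_act s p m = 0"
proof -
  have lin: "\<And>v. linear (s v)" and lin': "\<And>m. linear (\<lambda>v. s v m)"
    and sq: "\<And>v m. s v (s v m) = 0"
    using assms(1) by (auto simp: ext_action_def bilinear_def)
  from assms(2) show ?thesis
    by (induction arbitrary: m)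
      (simp_all add: free_act_diff free_act_add free_act_letter free_act_const
        free_act_mult[OF lin] linear_add[OF lin'] linear_scale[OF lin'] sq
        linear_0[OF free_act_linear[OF lin]])
qed

instantiation ext :: (real_vector) real_algebra_1
begin

lift_definition zero_ext :: "'a ext" is 0 .
lift_definition one_ext :: "'a ext" is 1 .

lift_definition plus_ext :: "'a ext \<Rightarrow> 'a ext \<Rightarrow> 'a ext" is "(+)"
  unfolding ext_rel_def by (metis add_diff_add ext_ideal.add)

lift_definition uminus_ext :: "'a ext \<Rightarrow> 'a ext" is uminus
  unfolding ext_rel_def by (metis ext_ideal_uminus minus_diff_minus)

lift_definition minus_ext :: "'a ext \<Rightarrow> 'a ext \<Rightarrow> 'a ext" is "(-)"
proof -
  fix p p' q q' :: "'a free_alg"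
  assume "ext_rel p p'" "ext_rel q q'"
  then have "(p - p') + - (q - q') \<in> ext_ideal"
    unfolding ext_rel_def by (intro ext_ideal.add ext_ideal_uminus)
  then show "ext_rel (p - q) (p' - q')" by (simp add: ext_rel_def algebra_simps)
qed

lift_definition times_ext :: "'a ext \<Rightarrow> 'a ext \<Rightarrow> 'a ext" is "(*)"
proof -
  fix p p' q q' :: "'a free_alg"
  assume "ext_rel p p'" "ext_rel q q'"
  then have "(p - p') * q + p' * (q - q') \<in> ext_ideal"
    unfolding ext_rel_def by (intro ext_ideal.intros)
  then show "ext_rel (p * q) (p' * q')" by (simp add: ext_rel_def algebra_simps)
qed

lift_definition scaleR_ext :: "real \<Rightarrow> 'a ext \<Rightarrow> 'a ext" is "\<lambda>c p. const c * p"
  unfolding ext_rel_def by (metis ext_ideal.mult_left right_diff_distrib)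

instance
proof
  fix a b c :: "'a ext" and r t :: real
  note rel = equivp_reflp[OF equivp_ext_rel]
  show "a + b + c = a + (b + c)" by transfer (simp add: add.assoc rel)
  show "a + b = b + a" by transfer (simp add: add.commute rel)
  show "0 + a = a" by transfer (simp add: rel)
  show "- a + a = 0" by transfer (simp add: rel)
  show "a - b = a + - b" by transfer (simp add: rel)
  show "a * b * c = a * (b * c)" by transfer (simp add: mult.assoc rel)
  show "(a + b) * c = a * c + b * c" by transfer (simp add: distrib_right rel)
  show "a * (b + c) = a * b + a * c" by transfer (simp add: distrib_left rel)
  show "1 * a = a" by transfer (simp add: rel)
  show "a * 1 = a" by transfer (simp add: rel)
  show "r *\<^sub>R (a + b) = r *\<^sub>R a + r *\<^sub>R b" by transfer (simp add: distrib_left rel)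
  show "(r + t) *\<^sub>R a = r *\<^sub>R a + t *\<^sub>R a" by transfer (simp add: const_add distrib_right rel)
  show "r *\<^sub>R t *\<^sub>R a = (r * t) *\<^sub>R a" by transfer (simp add: const_mult mult.assoc rel)
  show "1 *\<^sub>R a = a" by transfer (simp add: const_one rel)
  show "r *\<^sub>R a * b = r *\<^sub>R (a * b)" by transfer (simp add: mult.assoc rel)
  show "a * r *\<^sub>R b = r *\<^sub>R (a * b)"
    by transfer (metis mult.assoc const_central rel)
  show "(0::'a ext) \<noteq> 1"
  proof
    assume "(0::'a ext) = 1"
    then have "(0::'a free_alg) - 1 \<in> ext_ideal" by transfer (simp add: ext_rel_def)
    then have "(1::'a free_alg) \<in> ext_ideal" using ext_ideal_uminus by fastforce
    moreover have "ext_action (\<lambda>(v::'a) (m::real). 0)"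
      by (auto simp: ext_action_def bilinear_def intro: linearI)
    ultimately have "free_act (\<lambda>(v::'a) (m::real). 0) 1 1 = 0"
      by (rule free_act_ideal[rotated])
    then show False using free_act_const[of "\<lambda>(v::'a) (m::real). 0" 1 1] by (simp add: const_one)
  qed
qed

end

text \<open>Multiplication in \<^typ>\<open>'a ext\<close> is the outer product; \<open>\<iota>\<close> is the inclusion of the vectors.\<close>

lift_definition \<iota> :: "'a::real_vector \<Rightarrow> 'a ext" is letter .

lemma linear_\<iota>: "linear \<iota>"
proof (rule linearI)
  show "\<iota> (u + v) = \<iota> u + \<iota> v" for u v :: 'a
    by transfer (metis ext_rel_def ext_ideal.add_rel diff_diff_eq)
  show "\<iota> (c *\<^sub>R v) = c *\<^sub>R \<iota> v" for c and v :: 'a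
    by transfer (simp add: ext_rel_def ext_ideal.scale_rel)
qed

lemma \<iota>_square: "\<iota> v * \<iota> v = 0"
  by transfer (simp add: ext_rel_def ext_ideal.square_rel)

lemma ext_induct [case_names one letter add scale]:
  assumes "P 1" "\<And>v x. P x \<Longrightarrow> P (\<iota> v * x)" "\<And>x y. P x \<Longrightarrow> P y \<Longrightarrow> P (x + y)"
    "\<And>c x. P x \<Longrightarrow> P (c *\<^sub>R x)"
  shows "P x"
proof -
  have word: "P (abs_ext (Poly_Mapping.single (Word vs) 1))" for vs
  proof (induction vs)
    case Nil
    then show ?case
      using assms(1) by (simp add: one_ext_def flip: zero_ext_word_def)
  next
    case (Cons v vs)
    have "abs_ext (Poly_Mapping.single (Word (v # vs)) 1)
        = \<iota> v * abs_ext (Poly_Mapping.single (Word vs) 1)"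
      by (simp add: \<iota>.abs_eq times_ext.abs_eq letter_def mult_single plus_ext_word_def)
    then show ?case using Cons assms(2) by simp
  qed
  have "P (abs_ext p)" for p
  proof (induction p rule: single_induct)
    case (single w c)
    have "abs_ext (Poly_Mapping.single w c) = c *\<^sub>R abs_ext (Poly_Mapping.single w 1)"
      by (simp add: scaleR_ext.abs_eq const_def mult_single)
    then show ?case using word[of "letters w"] assms(4) by simp
  next
    case (add p q)
    then show ?case using assms(3) by (simp flip: plus_ext.abs_eq)
  qed
  then show ?thesis by (metis Quotient3_abs_rep[OF Quotient3_ext])
qed

definition ext_act :: "('a::real_vector \<Rightarrow> 'm \<Rightarrow> 'm) \<Rightarrow> 'a ext \<Rightarrow> 'm \<Rightarrow> 'm::real_vector"
  where "ext_act s x m = free_act s (rep_ext x) m"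

lemma ext_act_abs:
  assumes "ext_action s"
  shows "ext_act s (abs_ext p) m = free_act s p m"
proof -
  have "ext_rel (rep_ext (abs_ext p)) p"
    by (rule Quotient3_rep_abs[OF Quotient3_ext equivp_reflp[OF equivp_ext_rel]])
  then have "free_act s (rep_ext (abs_ext p) - p) m = 0"
    unfolding ext_rel_def using assms by (intro free_act_ideal)
  then show ?thesis by (simp add: ext_act_def free_act_diff)
qed

lemma
  assumes "ext_action s"
  shows ext_act_one: "ext_act s 1 m = m"
    and ext_act_letter: "ext_act s (\<iota> v) m = s v m"
    and ext_act_add: "ext_act s (x + y) m = ext_act s x m + ext_act s y m"
    and ext_act_scale: "ext_act s (c *\<^sub>R x) m = c *\<^sub>R ext_act s x m"
    and ext_act_mult: "ext_act s (x * y) m = ext_act s x (ext_act s y m)"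
proof -
  have lin: "\<And>v. linear (s v)" using assms by (auto simp: ext_action_def bilinear_def)
  obtain p q where [simp]: "x = abs_ext p" "y = abs_ext q"
    by (metis Quotient3_abs_rep[OF Quotient3_ext])
  show "ext_act s 1 m = m"
    using free_act_const[of s 1 m] by (simp add: one_ext_def ext_act_abs[OF assms] const_one)
  show "ext_act s (\<iota> v) m = s v m"
    by (simp add: \<iota>.abs_eq ext_act_abs[OF assms] free_act_letter)
  show "ext_act s (x + y) m = ext_act s x m + ext_act s y m"
    by (simp add: plus_ext.abs_eq ext_act_abs[OF assms] free_act_add)
  show "ext_act s (c *\<^sub>R x) m = c *\<^sub>R ext_act s x m"
    by (simp add: scaleR_ext.abs_eq ext_act_abs[OF assms] free_act_mult[OF lin] free_act_const)
  show "ext_act s (x * y) m = ext_act s x (ext_act s y m)"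
    by (simp add: times_ext.abs_eq ext_act_abs[OF assms] free_act_mult[OF lin])
qed

definition ext_power :: "nat \<Rightarrow> 'a::real_vector ext set"
  where "ext_power k = span {prod_list (map \<iota> vs) |vs. length vs = k}"

text \<open>
  \<open>ext_map f\<close> is the algebra homomorphism induced by \<open>f\<close>; its restriction to \<open>ext_power k\<close> is
  the \<open>k\<close>-th exterior power of \<open>f\<close>.  It is meaningful for linear \<open>f\<close>.
\<close>

definition ext_map :: "('a::real_vector \<Rightarrow> 'b::real_vector) \<Rightarrow> 'a ext \<Rightarrow> 'b ext"
  where "ext_map f x = ext_act (\<lambda>v y. \<iota> (f v) * y) x 1"

lemma ext_action_map:
  assumes "linear f"
  shows "ext_action (\<lambda>v y. \<iota> (f v) * y)"
proof -
  have [simp]: "\<iota> v * (\<iota> v * y) = 0" for v :: 'b and y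
    by (simp add: \<iota>_square flip: mult.assoc)
  show ?thesis
    unfolding ext_action_def bilinear_def
    by (auto intro!: linearI simp: linear_add[OF assms] linear_scale[OF assms]
        linear_add[OF linear_\<iota>] linear_scale[OF linear_\<iota>] algebra_simps)
qed

lemma
  assumes "linear f"
  shows linear_ext_map: "linear (ext_map f)"
    and ext_map_one: "ext_map f 1 = 1"
    and ext_map_\<iota>: "ext_map f (\<iota> v) = \<iota> (f v)"
    and ext_map_mult: "ext_map f (x * y) = ext_map f x * ext_map f y"
proof -
  note act = ext_action_map[OF assms]
  show "linear (ext_map f)"
    by (rule linearI) (simp_all add: ext_map_def ext_act_add[OF act] ext_act_scale[OF act])
  show "ext_map f 1 = 1"
    by (simp add: ext_map_def ext_act_one[OF act])
  show "ext_map f (\<iota> v) = \<iota> (f v)"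
    by (simp add: ext_map_def ext_act_letter[OF act])
  have free: "ext_act (\<lambda>v y. \<iota> (f v) * y) x m = ext_map f x * m" for m
    by (induction x rule: ext_induct)
      (simp_all add: ext_map_def ext_act_add[OF act] ext_act_scale[OF act] ext_act_one[OF act]
        ext_act_mult[OF act] ext_act_letter[OF act] distrib_right mult.assoc)
  show "ext_map f (x * y) = ext_map f x * ext_map f y"
    unfolding ext_map_def[of f "x * y"] ext_act_mult[OF act]
    by (simp only: free) (simp only: ext_map_def)
qed

lemma ext_map_ext_power:
  assumes "linear f" "x \<in> ext_power k"
  shows "ext_map f x \<in> ext_power k"
proof -
  have prod: "ext_map f (prod_list (map \<iota> vs)) = prod_list (map \<iota> (map f vs))" for vs
    by (induction vs) (simp_all add: ext_map_one ext_map_mult ext_map_\<iota> assms(1))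
  have "ext_map f ` {prod_list (map \<iota> vs) |vs. length vs = k}
      \<subseteq> {prod_list (map \<iota> vs) |vs. length vs = k}"
    by (force simp only: prod length_map)
  then have "ext_map f ` ext_power k \<subseteq> ext_power k"
    unfolding ext_power_def linear_span_image[OF linear_ext_map[OF assms(1)], symmetric]
    by (rule span_mono)
  then show ?thesis using assms(2) by blast
qed

text \<open>
  The contraction with a linear functional \<open>\<phi>\<close> is the antiderivation extending \<open>\<phi>\<close>.  The action
  below works on pairs \<open>(x, contraction \<phi> x)\<close>.
\<close>

definition contraction :: "('a::real_vector \<Rightarrow> real) \<Rightarrow> 'a ext \<Rightarrow> 'a ext"
  where "contraction \<phi> x
    = snd (ext_act (\<lambda>v p. (\<iota> v * fst p, \<phi> v *\<^sub>R fst p - \<iota> v * snd p)) x (1, 0))"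

lemma ext_action_contraction:
  assumes "linear \<phi>"
  shows "ext_action (\<lambda>v p. (\<iota> v * fst p, \<phi> v *\<^sub>R fst p - \<iota> v * snd p))"
proof -
  have [simp]: "\<iota> v * (\<iota> v * y) = 0" for v :: 'a and y
    by (simp add: \<iota>_square flip: mult.assoc)
  show ?thesis
    unfolding ext_action_def bilinear_def
    by (auto intro!: linearI simp: linear_add[OF assms] linear_scale[OF assms]
        linear_add[OF linear_\<iota>] linear_scale[OF linear_\<iota>] algebra_simps zero_prod_def)
qed

lemma
  assumes "linear \<phi>"
  shows linear_contraction: "linear (contraction \<phi>)"
    and contraction_one: "contraction \<phi> 1 = 0"
    and contraction_\<iota>_mult: "contraction \<phi> (\<iota> v * x) = \<phi> v *\<^sub>R x - \<iota> v * contraction \<phi> x"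
proof -
  let ?s = "\<lambda>v p. (\<iota> v * fst p, \<phi> v *\<^sub>R fst p - \<iota> v * snd p)"
  note act = ext_action_contraction[OF assms]
  show "linear (contraction \<phi>)"
    by (rule linearI) (simp_all add: contraction_def ext_act_add[OF act] ext_act_scale[OF act])
  show "contraction \<phi> 1 = 0"
    by (simp add: contraction_def ext_act_one[OF act])
  have "fst (ext_act ?s x (1, 0)) = x"
    by (induction x rule: ext_induct)
      (simp_all add: ext_act_add[OF act] ext_act_scale[OF act] ext_act_one[OF act]
        ext_act_mult[OF act] ext_act_letter[OF act])
  then show "contraction \<phi> (\<iota> v * x) = \<phi> v *\<^sub>R x - \<iota> v * contraction \<phi> x"
    by (simp add: contraction_def ext_act_mult[OF act] ext_act_letter[OF act])
qed

lemma contraction_trivector: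
  assumes "linear \<phi>"
  shows "contraction \<phi> (\<iota> a * \<iota> b * \<iota> c)
    = \<phi> a *\<^sub>R (\<iota> b * \<iota> c) - \<phi> b *\<^sub>R (\<iota> a * \<iota> c) + \<phi> c *\<^sub>R (\<iota> a * \<iota> b)"
proof -
  have "contraction \<phi> (\<iota> c) = \<phi> c *\<^sub>R 1"
    using contraction_\<iota>_mult[OF assms, of c 1] by (simp add: contraction_one[OF assms])
  then show ?thesis
    by (simp add: contraction_\<iota>_mult[OF assms] mult.assoc right_diff_distrib)
qed


section \<open>The space of line coordinates\<close>

text \<open>
  Vectors of \<open>\<real>\<^sup>4\<close> have the components \<open>0, 1, 2, 3 :: 4\<close>, and \<open>\<real>\<^sup>3\<close> is the span of
  \<open>e 1, e 2, e 3\<close>.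
\<close>

abbreviation e :: "4 \<Rightarrow> real^4" where "e i \<equiv> axis i 1"

definition incl3 :: "real^3 \<Rightarrow> real^4"
  where "incl3 x = x$1 *\<^sub>R e 1 + x$2 *\<^sub>R e 2 + x$3 *\<^sub>R e 3"

definition proj3 :: "real^4 \<Rightarrow> real^3"
  where "proj3 X = vector [X$1, X$2, X$3]"

text \<open>
  The second exterior power of \<open>\<real>\<^sup>4\<close> is given by coordinates: the pair \<open>(u, u')\<close> stands for
  \<open>\<Sum>i. u\<^sub>i E\<^sub>i + u'\<^sub>i E'\<^sub>i\<close>.  The lemma \<open>wedge2_universal\<close> shows that this, together with
  \<open>wedge2\<close>, is the second exterior power.
\<close>

type_synonym R33 = "(real^3) \<times> (real^3)"

definition wedge2 :: "real^4 \<Rightarrow> real^4 \<Rightarrow> R33"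
  where "wedge2 a b = (a$0 *\<^sub>R proj3 b - b$0 *\<^sub>R proj3 a, cross3 (proj3 a) (proj3 b))"

definition E :: "real^3 \<Rightarrow> R33" where "E x = (x, 0)"
definition E' :: "real^3 \<Rightarrow> R33" where "E' x = (0, x)"

definition lift2 :: "(real^4 \<Rightarrow> real^4 \<Rightarrow> 'b) \<Rightarrow> R33 \<Rightarrow> 'b::real_vector"
  where "lift2 f = (\<lambda>(u, u').
      u$1 *\<^sub>R f (e 0) (e 1) + u$2 *\<^sub>R f (e 0) (e 2) + u$3 *\<^sub>R f (e 0) (e 3)
    + u'$1 *\<^sub>R f (e 2) (e 3) + u'$2 *\<^sub>R f (e 3) (e 1) + u'$3 *\<^sub>R f (e 1) (e 2))"

definition ext2_map :: "(real^4 \<Rightarrow> real^4) \<Rightarrow> R33 \<Rightarrow> R33"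
  where "ext2_map f = lift2 (\<lambda>a b. wedge2 (f a) (f b))"

lemma four_eq_zero: "(4::4) = 0"
  by simp

lemma ne4 [simp]: "(1::4) \<noteq> 0" "(2::4) \<noteq> 0" "(3::4) \<noteq> 0" "(0::4) \<noteq> 1" "(0::4) \<noteq> 2" "(0::4) \<noteq> 3"
  "(1::4) \<noteq> 2" "(1::4) \<noteq> 3" "(2::4) \<noteq> 1" "(2::4) \<noteq> 3" "(3::4) \<noteq> 1" "(3::4) \<noteq> 2"
  by simp_all

lemma proj3_nth [simp]: "proj3 X $ 1 = X$1" "proj3 X $ 2 = X$2" "proj3 X $ 3 = X$3"
  by (simp_all add: proj3_def)

lemma forall4: "(\<forall>i::4. P i) \<longleftrightarrow> P 0 \<and> P 1 \<and> P 2 \<and> P 3"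
  by (metis exhaust_4 four_eq_zero)

lemma vec4_expand: "X = X$0 *\<^sub>R e 0 + X$1 *\<^sub>R e 1 + X$2 *\<^sub>R e 2 + X$3 *\<^sub>R e 3"
  by (simp add: vec_eq_iff forall4 axis_def)

lemma vec4_decompose: "X = X$0 *\<^sub>R e 0 + incl3 (proj3 X)"
  by (simp add: vec_eq_iff forall4 axis_def incl3_def)

lemma E_eq_wedge2:
  "E x = wedge2 (e 0) (incl3 x)"
  "E' (axis 1 1) = wedge2 (e 2) (e 3)"
  "E' (axis 2 1) = wedge2 (e 3) (e 1)"
  "E' (axis 3 1) = wedge2 (e 1) (e 2)"
  by (simp_all add: E_def E'_def wedge2_def incl3_def vec_eq_iff forall_3 axis_def cross3_def)

lemma bilinear_wedge2: "bilinear wedge2"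
  unfolding bilinear_def
  by (auto intro!: linearI simp: wedge2_def vec_eq_iff forall_3 cross3_def algebra_simps)

lemma wedge2_self: "wedge2 a a = 0"
  by (simp add: wedge2_def zero_prod_def)

lemma linear_lift2: "linear (lift2 f)"
  by (rule linearI) (auto simp: lift2_def algebra_simps)

lemma lift2_wedge2:
  assumes "bilinear f" and sq: "\<And>a. f a a = 0"
  shows "lift2 f (wedge2 a b) = f a b"
proof -
  note bil = bilinear_ladd[OF assms(1)] bilinear_radd[OF assms(1)]
    bilinear_lmul[OF assms(1)] bilinear_rmul[OF assms(1)]
  have swap: "f x y = - f y x" for x y
  proof -
    have "f x y + f y x = f (x + y) (x + y)" unfolding bil by (simp add: sq)
    also have "\<dots> = 0" by (rule sq)
    finally show ?thesis by (simp only: eq_neg_iff_add_eq_0)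
  qed
  have "f a b = f (a$0 *\<^sub>R e 0 + a$1 *\<^sub>R e 1 + a$2 *\<^sub>R e 2 + a$3 *\<^sub>R e 3)
      (b$0 *\<^sub>R e 0 + b$1 *\<^sub>R e 1 + b$2 *\<^sub>R e 2 + b$3 *\<^sub>R e 3)"
    by (simp flip: vec4_expand)
  also have "\<dots> = lift2 f (wedge2 a b)"
    unfolding bil
    by (simp add: sq swap[of "e 1" "e 0"] swap[of "e 2" "e 0"] swap[of "e 3" "e 0"]
        swap[of "e 3" "e 2"] swap[of "e 1" "e 3"] swap[of "e 2" "e 1"])
      (simp add: lift2_def wedge2_def cross3_def algebra_simps)
  finally show ?thesis ..
qed

lemma wedge2_universal:
  fixes f :: "real^4 \<Rightarrow> real^4 \<Rightarrow> 'b::real_vector"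
  assumes "bilinear f" "\<And>a. f a a = 0"
  shows "\<exists>!g. linear g \<and> (\<forall>a b. g (wedge2 a b) = f a b)"
proof (rule ex1I)
  show "linear (lift2 f) \<and> (\<forall>a b. lift2 f (wedge2 a b) = f a b)"
    using linear_lift2 lift2_wedge2[OF assms] by blast
next
  fix g assume g: "linear g \<and> (\<forall>a b. g (wedge2 a b) = f a b)"
  show "g = lift2 f"
  proof
    fix w :: R33
    have "w = lift2 wedge2 w"
      by (simp add: lift2_def wedge2_def split_def prod_eq_iff vec_eq_iff forall_3 axis_def cross3_def)
    then have "g w = g (lift2 wedge2 w)" by simp
    also have "\<dots> = lift2 f w"
      using g by (simp add: lift2_def split_def linear_add linear_scale)
    finally show "g w = lift2 f w" .
  qed
qed

lemma linear_ext2_map: "linear (ext2_map f)"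
  by (simp add: ext2_map_def linear_lift2)

lemma ext2_map_wedge2:
  assumes "linear f"
  shows "ext2_map f (wedge2 a b) = wedge2 (f a) (f b)"
  unfolding ext2_map_def
proof (rule lift2_wedge2)
  show "bilinear (\<lambda>a b. wedge2 (f a) (f b))"
    unfolding bilinear_def
    by (auto intro!: linearI simp: linear_add[OF assms] linear_scale[OF assms]
        bilinear_ladd[OF bilinear_wedge2] bilinear_radd[OF bilinear_wedge2]
        bilinear_lmul[OF bilinear_wedge2] bilinear_rmul[OF bilinear_wedge2])
qed (rule wedge2_self)

text \<open>The form \<open>E\<^sub>i \<cdot> E'\<^sub>j = \<delta>\<^sub>i\<^sub>j\<close>, not the inner product of the product type.\<close>

definition form33 :: "R33 \<Rightarrow> R33 \<Rightarrow> real"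
  where "form33 a b = fst a \<bullet> snd b + snd a \<bullet> fst b"

lemma linear_form33: "linear (form33 a)"
  by (rule linearI) (simp_all add: form33_def inner_add_right distrib_left)

definition J :: "R33 \<Rightarrow> R33" where "J = prod.swap"

lemma linear_J: "linear J"
  by (rule linearI) (auto simp: J_def)

lemma J_E: "J (E x) = E' x" "J (E' x) = E x"
  by (simp_all add: J_def E_def E'_def)


section \<open>The representations of points and planes\<close>

definition I3 :: "R33 ext"
  where "I3 = \<iota> (E (axis 1 1)) * \<iota> (E (axis 2 1)) * \<iota> (E (axis 3 1))"

definition J3 :: "R33 ext"
  where "J3 = \<iota> (E' (axis 1 1)) * \<iota> (E' (axis 2 1)) * \<iota> (E' (axis 3 1))"

definition K2 :: "R33 ext"
  where "K2 = (\<Sum>i\<in>UNIV. \<iota> (E (axis i 1)) * \<iota> (E' (axis i 1)))"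

definition point_rep :: "real^4 \<Rightarrow> R33 ext"
  where "point_rep X = (let x0 = X$0; x = proj3 X in
      \<iota> (E x) * contraction (form33 (E x)) J3 - x0 *\<^sub>R (\<iota> (E x) * K2) + x0\<^sup>2 *\<^sub>R I3)"

definition plane_rep :: "real^4 \<Rightarrow> R33 ext"
  where "plane_rep N = (let d = N$0; n = proj3 N in
      \<iota> (E' n) * contraction (form33 (E' n)) I3 + d *\<^sub>R (\<iota> (E' n) * K2) + d\<^sup>2 *\<^sub>R J3)"

lemma trivector_in_ext_power: "\<iota> a * \<iota> b * \<iota> c \<in> ext_power 3"
  unfolding ext_power_def
  by (rule span_base) (auto intro!: exI[of _ "[a, b, c]"] simp: mult.assoc)

lemma trivector_in_ext_power': "\<iota> a * (\<iota> b * \<iota> c) \<in> ext_power 3"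
  using trivector_in_ext_power by (simp add: mult.assoc)

lemma rep_in_ext_power: "point_rep X \<in> ext_power 3" "plane_rep X \<in> ext_power 3"
proof -
  have sub: "subspace (ext_power 3 :: R33 ext set)" by (simp add: ext_power_def)
  note mem = subspace_add[OF sub] subspace_diff[OF sub] subspace_scale[OF sub]
    trivector_in_ext_power trivector_in_ext_power'
  show "point_rep X \<in> ext_power 3"
    unfolding point_rep_def I3_def J3_def K2_def Let_def sum_3
      contraction_trivector[OF linear_form33] distrib_left right_diff_distrib mult_scaleR_right
    by (intro mem)
  show "plane_rep X \<in> ext_power 3"
    unfolding plane_rep_def I3_def J3_def K2_def Let_def sum_3
      contraction_trivector[OF linear_form33] distrib_left right_diff_distrib mult_scaleR_right
    by (intro mem)
qed

end

theory Submission
  imports Defs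
begin

text \<open>
  The representation \<open>point_rep X\<close> is characterised by
  \<open>(X \<and> a) \<and> (X \<and> b) \<and> (X \<and> c) = det (X, a, b, c) point_rep X\<close>: both sides are
  alternating in \<open>a, b, c\<close>, so it suffices to take three basis vectors.  Choosing \<open>a, b, c\<close> with
  \<open>det (X, a, b, c) \<noteq> 0\<close> and applying \<open>A\<close> to all four vectors gives the first identity by
  multiplicativity of \<open>det\<close>.  Since \<open>J\<close> carries \<open>point_rep X\<close> to \<open>plane_rep X\<close>, conjugating
  the first identity for \<open>A\<^sup>-\<^sup>T\<close> with the involution \<open>J\<close> gives the second.
\<close>

text \<open>Polynomial identities are settled by bringing both sides to the same sorted sum of
  signed monomials. Outer products do not commute, so there \<open>ac_simps\<close> only
  reassociates, while scalar coefficients are fully sorted.\<close>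

lemmas expand_to_monomials = diff_conv_add_uminus distrib_left distrib_right minus_add_distrib
  minus_minus mult_minus_left mult_minus_right ac_simps

lemmas expand_to_scaled_monomials = scaleR_add_left scaleR_add_right scaleR_scaleR
  scaleR_minus_left scaleR_minus_right mult_scaleR_left mult_scaleR_right mult_zero_right
  scaleR_zero_right minus_zero add_0_left add_0_right expand_to_monomials

text \<open>Laplace expansion along row 0. The permutations of the four indices are enumerated by
  inserting one index at a time, each insertion contributing a transposition.\<close>

lemma det_4:
  fixes A :: "'a::comm_ring_1^4^4"
  shows "det A =
      A$0$0 * (A$1$1 * A$2$2 * A$3$3 + A$1$2 * A$2$3 * A$3$1 + A$1$3 * A$2$1 * A$3$2
             - A$1$1 * A$2$3 * A$3$2 - A$1$2 * A$2$1 * A$3$3 - A$1$3 * A$2$2 * A$3$1)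
    - A$0$1 * (A$1$0 * A$2$2 * A$3$3 + A$1$2 * A$2$3 * A$3$0 + A$1$3 * A$2$0 * A$3$2
             - A$1$0 * A$2$3 * A$3$2 - A$1$2 * A$2$0 * A$3$3 - A$1$3 * A$2$2 * A$3$0)
    + A$0$2 * (A$1$0 * A$2$1 * A$3$3 + A$1$1 * A$2$3 * A$3$0 + A$1$3 * A$2$0 * A$3$1
             - A$1$0 * A$2$3 * A$3$1 - A$1$1 * A$2$0 * A$3$3 - A$1$3 * A$2$1 * A$3$0)
    - A$0$3 * (A$1$0 * A$2$1 * A$3$2 + A$1$1 * A$2$2 * A$3$0 + A$1$2 * A$2$0 * A$3$1
             - A$1$0 * A$2$2 * A$3$1 - A$1$1 * A$2$0 * A$3$2 - A$1$2 * A$2$1 * A$3$0)"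
proof -
  have U: "(UNIV :: 4 set) = {0, 1, 2, 3}"
    using forall4[of "\<lambda>i. i \<in> {0, 1, 2, 3}"] by auto
  have f0: "finite {1::4, 2, 3}" "0 \<notin> {1::4, 2, 3}"
    and f1: "finite {2::4, 3}" "1 \<notin> {2::4, 3}"
    and f2: "finite {3::4}" "2 \<notin> {3::4}"
    by auto
  show ?thesis
    unfolding det_def U sum_over_permutations_insert[OF f0]
      sum_over_permutations_insert[OF f1] sum_over_permutations_insert[OF f2] permutes_sing
    by (simp add: sign_swap_id permutation_swap_id sign_compose sign_id permutation_compose
        Transposition.transpose_def)
      (simp only: expand_to_monomials)
qed

text \<open>Polarisation of \<open>\<iota>_square\<close> at \<open>u + v\<close>.\<close>

lemma \<iota>_anticomm: "\<iota> v * \<iota> u = - (\<iota> u * \<iota> v)"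
proof -
  have "\<iota> (u + v) * \<iota> (u + v) = \<iota> u * \<iota> v + \<iota> v * \<iota> u"
    by (simp add: linear_add[OF linear_\<iota>] \<iota>_square algebra_simps)
  then show ?thesis
    by (simp add: \<iota>_square eq_neg_iff_add_eq_0 add.commute)
qed

text \<open>In products associated to the right, swapping two factors that are not the last ones
  needs the trailing \<open>x\<close> to match.\<close>

lemma \<iota>_anticomm_left: "\<iota> v * (\<iota> u * x) = - (\<iota> u * (\<iota> v * x))"
  using arg_cong[OF \<iota>_anticomm[of v u], of "\<lambda>y. y * x"] by (simp add: mult.assoc)

lemma \<iota>_square_left: "\<iota> v * (\<iota> v * x) = 0"
  by (simp add: \<iota>_square flip: mult.assoc)

text \<open>Cauchy-Binet for threefold products: the coefficients are the 3 by 3 minors of the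
  matrix with rows \<open>a\<close>, \<open>b\<close>, \<open>c\<close>, one for each choice of
  increasing columns.\<close>

lemma trivector_minors:
  fixes u :: "4 \<Rightarrow> 'a::real_vector"
  defines "w \<equiv> \<lambda>i j k. \<iota> (u i) * \<iota> (u j) * \<iota> (u k)"
  shows "\<iota> (\<Sum>i\<in>UNIV. a i *\<^sub>R u i) * \<iota> (\<Sum>i\<in>UNIV. b i *\<^sub>R u i) * \<iota> (\<Sum>i\<in>UNIV. c i *\<^sub>R u i)
    = (a 1 * b 2 * c 3 + a 2 * b 3 * c 1 + a 3 * b 1 * c 2
        - a 1 * b 3 * c 2 - a 2 * b 1 * c 3 - a 3 * b 2 * c 1) *\<^sub>R w 1 2 3
    + (a 0 * b 2 * c 3 + a 2 * b 3 * c 0 + a 3 * b 0 * c 2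
        - a 0 * b 3 * c 2 - a 2 * b 0 * c 3 - a 3 * b 2 * c 0) *\<^sub>R w 0 2 3
    + (a 0 * b 1 * c 3 + a 1 * b 3 * c 0 + a 3 * b 0 * c 1
        - a 0 * b 3 * c 1 - a 1 * b 0 * c 3 - a 3 * b 1 * c 0) *\<^sub>R w 0 1 3
    + (a 0 * b 1 * c 2 + a 1 * b 2 * c 0 + a 2 * b 0 * c 1
        - a 0 * b 2 * c 1 - a 1 * b 0 * c 2 - a 2 * b 1 * c 0) *\<^sub>R w 0 1 2"
proof -
  \<comment> \<open>Only the instances that move the smaller index to the left are supplied, so
    rewriting sorts the factors and terminates.\<close>
  note anti = \<iota>_anticomm[of "u 1" "u 0"] \<iota>_anticomm[of "u 2" "u 0"] \<iota>_anticomm[of "u 3" "u 0"]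
    \<iota>_anticomm[of "u 2" "u 1"] \<iota>_anticomm[of "u 3" "u 1"] \<iota>_anticomm[of "u 3" "u 2"]
  note anti_left = \<iota>_anticomm_left[of "u 1" "u 0"] \<iota>_anticomm_left[of "u 2" "u 0"]
    \<iota>_anticomm_left[of "u 3" "u 0"] \<iota>_anticomm_left[of "u 2" "u 1"]
    \<iota>_anticomm_left[of "u 3" "u 1"] \<iota>_anticomm_left[of "u 3" "u 2"]
  show ?thesis
    by (simp only: w_def sum_4 four_eq_zero linear_add[OF linear_\<iota>] linear_scale[OF linear_\<iota>]
        anti anti_left \<iota>_square \<iota>_square_left expand_to_scaled_monomials)
qed

lemma E_expand:
  "E x = x$1 *\<^sub>R E (axis 1 1) + x$2 *\<^sub>R E (axis 2 1) + x$3 *\<^sub>R E (axis 3 1)"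
  by (simp add: E_def vec_eq_iff forall_3 axis_def)

lemma E_zero: "E 0 = 0"
  by (simp add: E_def zero_prod_def)

lemma form33_E:
  "form33 (E x) (E' y) = x \<bullet> y" "form33 (E' x) (E y) = x \<bullet> y"
  by (simp_all add: form33_def E_def E'_def)

text \<open>\<open>J\<close> reverses the two factors of each summand. The resulting sign accounts
  for the opposite signs of the \<open>K2\<close> terms in \<open>point_rep\<close> and
  \<open>plane_rep\<close>.\<close>

lemma ext_map_J_K2: "ext_map J K2 = - K2"
proof -
  have "ext_map J K2 = (\<Sum>i\<in>UNIV. \<iota> (E' (axis i 1)) * \<iota> (E (axis i 1)))"
    by (simp add: K2_def linear_sum[OF linear_ext_map] ext_map_mult ext_map_\<iota> linear_J J_E)
  also have "\<dots> = - K2"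
    unfolding K2_def sum_negf[symmetric] by (intro sum.cong refl \<iota>_anticomm)
  finally show ?thesis .
qed

lemma ext_map_J_point_rep: "ext_map J (point_rep X) = plane_rep X"
  by (simp add: point_rep_def plane_rep_def Let_def I3_def J3_def
      linear_add[OF linear_ext_map] linear_diff[OF linear_ext_map] linear_scale[OF linear_ext_map]
      ext_map_mult ext_map_\<iota> linear_J J_E contraction_trivector linear_form33
      form33_E ext_map_J_K2)

text \<open>The case of basis vectors in the characterisation of \<open>point_rep\<close>: the
  scalars are the determinants with rows \<open>X\<close>, \<open>e i\<close>, \<open>e j\<close>,
  \<open>e k\<close>.\<close>

lemma wedge2_basis_products:
  defines "w \<equiv> \<lambda>X i j k. \<iota> (wedge2 X (e i)) * \<iota> (wedge2 X (e j)) * \<iota> (wedge2 X (e k))"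
  shows "w X 1 2 3 = X$0 *\<^sub>R point_rep X"
    and "w X 0 2 3 = - (X$1 *\<^sub>R point_rep X)"
    and "w X 0 1 3 = X$2 *\<^sub>R point_rep X"
    and "w X 0 1 2 = - (X$3 *\<^sub>R point_rep X)"
proof -
  \<comment> \<open>Opaque names for the basis; the sorting rules below order factors as
    \<open>E1\<close>, \<open>E2\<close>, \<open>E3\<close>, \<open>F1\<close>, \<open>F2\<close>,
    \<open>F3\<close>.\<close>
  define E1 E2 E3 F1 F2 F3 where EF: "E1 = E (axis 1 1)" "E2 = E (axis 2 1)" "E3 = E (axis 3 1)"
    "F1 = E' (axis 1 1)" "F2 = E' (axis 2 1)" "F3 = E' (axis 3 1)"
  have W: "wedge2 X (e 0) = - (X$1 *\<^sub>R E1) - X$2 *\<^sub>R E2 - X$3 *\<^sub>R E3"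
    "wedge2 X (e 1) = X$0 *\<^sub>R E1 + X$3 *\<^sub>R F2 - X$2 *\<^sub>R F3"
    "wedge2 X (e 2) = X$0 *\<^sub>R E2 - X$3 *\<^sub>R F1 + X$1 *\<^sub>R F3"
    "wedge2 X (e 3) = X$0 *\<^sub>R E3 + X$2 *\<^sub>R F1 - X$1 *\<^sub>R F2"
    by (simp_all add: EF E_def E'_def wedge2_def cross3_def vec_eq_iff forall_3 axis_def)
  have x: "\<iota> (E (proj3 X)) = X$1 *\<^sub>R \<iota> E1 + X$2 *\<^sub>R \<iota> E2 + X$3 *\<^sub>R \<iota> E3"
    unfolding EF by (subst E_expand) (simp add: linear_add[OF linear_\<iota>] linear_scale[OF linear_\<iota>])
  have f: "form33 (E (proj3 X)) F1 = X$1" "form33 (E (proj3 X)) F2 = X$2" "form33 (E (proj3 X)) F3 = X$3"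
    by (simp_all add: EF form33_E inner_axis)
  have P: "point_rep X =
      (X$1 *\<^sub>R \<iota> E1 + X$2 *\<^sub>R \<iota> E2 + X$3 *\<^sub>R \<iota> E3)
        * (X$1 *\<^sub>R (\<iota> F2 * \<iota> F3) - X$2 *\<^sub>R (\<iota> F1 * \<iota> F3) + X$3 *\<^sub>R (\<iota> F1 * \<iota> F2))
      - X$0 *\<^sub>R ((X$1 *\<^sub>R \<iota> E1 + X$2 *\<^sub>R \<iota> E2 + X$3 *\<^sub>R \<iota> E3)
        * (\<iota> E1 * \<iota> F1 + \<iota> E2 * \<iota> F2 + \<iota> E3 * \<iota> F3))
      + (X$0)\<^sup>2 *\<^sub>R (\<iota> E1 * \<iota> E2 * \<iota> E3)"
    by (simp add: point_rep_def Let_def I3_def J3_def K2_def sum_3 contraction_trivector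
        linear_form33 x f flip: EF)
  note anti = \<iota>_anticomm[of E2 E1] \<iota>_anticomm[of E3 E1] \<iota>_anticomm[of E3 E2]
    \<iota>_anticomm[of F2 F1] \<iota>_anticomm[of F3 F1] \<iota>_anticomm[of F3 F2]
    \<iota>_anticomm[of F1 E1] \<iota>_anticomm[of F1 E2] \<iota>_anticomm[of F1 E3]
    \<iota>_anticomm[of F2 E1] \<iota>_anticomm[of F2 E2] \<iota>_anticomm[of F2 E3]
    \<iota>_anticomm[of F3 E1] \<iota>_anticomm[of F3 E2] \<iota>_anticomm[of F3 E3]
  note anti_left = \<iota>_anticomm_left[of E2 E1] \<iota>_anticomm_left[of E3 E1] \<iota>_anticomm_left[of E3 E2]
    \<iota>_anticomm_left[of F2 F1] \<iota>_anticomm_left[of F3 F1] \<iota>_anticomm_left[of F3 F2]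
    \<iota>_anticomm_left[of F1 E1] \<iota>_anticomm_left[of F1 E2] \<iota>_anticomm_left[of F1 E3]
    \<iota>_anticomm_left[of F2 E1] \<iota>_anticomm_left[of F2 E2] \<iota>_anticomm_left[of F2 E3]
    \<iota>_anticomm_left[of F3 E1] \<iota>_anticomm_left[of F3 E2] \<iota>_anticomm_left[of F3 E3]
  note norm = w_def W P linear_add[OF linear_\<iota>] linear_diff[OF linear_\<iota>] linear_neg[OF linear_\<iota>]
    linear_scale[OF linear_\<iota>] anti anti_left \<iota>_square \<iota>_square_left
    power2_eq_square expand_to_scaled_monomials
  \<comment> \<open>Sorting does not cancel opposite monomials, such as the two multiples of
    \<open>\<iota> F1 * (\<iota> F2 * \<iota> F3)\<close> here; the final \<open>simp\<close>
    does.\<close>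
  show "w X 1 2 3 = X$0 *\<^sub>R point_rep X"
    by (simp only: norm) simp
  show "w X 0 2 3 = - (X$1 *\<^sub>R point_rep X)"
    by (simp only: norm) simp
  show "w X 0 1 3 = X$2 *\<^sub>R point_rep X"
    by (simp only: norm) simp
  show "w X 0 1 2 = - (X$3 *\<^sub>R point_rep X)"
    by (simp only: norm) simp
qed

text \<open>Expanding rows 1 to 3 in the basis yields their minors, weighted by the signed entries
  of row 0: the Laplace expansion of \<open>det M\<close>.\<close>

lemma wedge2_product_eq_det:
  "\<iota> (wedge2 (M$0) (M$1)) * \<iota> (wedge2 (M$0) (M$2)) * \<iota> (wedge2 (M$0) (M$3))
    = det M *\<^sub>R point_rep (M$0)"
proof -
  have w: "wedge2 (M$0) a = (\<Sum>i\<in>UNIV. a$i *\<^sub>R wedge2 (M$0) (e i))" for a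
  proof -
    have "wedge2 (M$0) a = wedge2 (M$0) (\<Sum>i\<in>UNIV. a$i *\<^sub>R e i)"
      by (simp add: basis_expansion flip: scalar_mult_eq_scaleR)
    then show ?thesis
      using bilinear_wedge2 by (simp add: bilinear_def linear_sum linear_scale)
  qed
  show ?thesis
    unfolding w[of "M$1"] w[of "M$2"] w[of "M$3"] trivector_minors wedge2_basis_products det_4
    by (simp only: expand_to_scaled_monomials)
qed

lemma ext_map_point_rep:
  fixes A :: "real^4^4"
  shows "ext_map (ext2_map ((*v) A)) (point_rep X) = det A *\<^sub>R point_rep (A *v X)"
proof (cases "X = 0")
  \<comment> \<open>The zero vector cannot be completed to a basis, but both sides vanish.\<close>
  case True
  have "proj3 0 = 0" by (simp add: vec_eq_iff forall_3)
  then have "point_rep 0 = 0"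
    by (simp add: point_rep_def Let_def E_zero linear_0[OF linear_\<iota>])
  then show ?thesis using True by (simp add: linear_0[OF linear_ext_map[OF linear_ext2_map]])
next
  case False
  then obtain l where l: "X$l \<noteq> 0" by (auto simp: vec_eq_iff)
  \<comment> \<open>The identity matrix with row 0 replaced by \<open>X\<close> and, for nonzero
    \<open>l\<close>, row \<open>l\<close> by \<open>e 0\<close>; its determinant is
    \<open>X$l\<close> up to sign.\<close>
  define N :: "4 \<Rightarrow> real^4^4"
    where "N l = (\<chi> i. if i = 0 then X else if i = l then e 0 else e i)" for l
  have N0: "N l $ 0 = X" for l by (simp add: N_def)
  have "\<forall>l. det (N l) = (if l = 0 then X$l else - X$l)"
    unfolding forall4 by (simp add: N_def det_4 axis_def)
  then have "det (N l) \<noteq> 0" using l by (cases "l = 0") auto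
  let ?N = "N l"
  \<comment> \<open>Right multiplication by the transpose applies \<open>A\<close> to every row at
    once.\<close>
  have row: "(?N ** transpose A) $ i = A *v (?N$i)" for i
    by (simp add: vec_eq_iff matrix_matrix_mult_def matrix_vector_mult_def transpose_def mult.commute)
  have "det ?N *\<^sub>R ext_map (ext2_map ((*v) A)) (point_rep X)
      = ext_map (ext2_map ((*v) A)) (det ?N *\<^sub>R point_rep (?N$0))"
    by (simp add: N0 linear_scale[OF linear_ext_map[OF linear_ext2_map]])
  also have "\<dots> = det (?N ** transpose A) *\<^sub>R point_rep ((?N ** transpose A)$0)"
    unfolding wedge2_product_eq_det[symmetric]
    by (simp add: row ext_map_mult ext_map_\<iota> linear_ext2_map ext2_map_wedge2)
  also have "\<dots> = det ?N *\<^sub>R (det A *\<^sub>R point_rep (A *v X))"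
    by (simp add: row N0 det_mul)
  finally show ?thesis using \<open>det ?N \<noteq> 0\<close> by (simp only: scaleR_cancel_left) simp
qed

text \<open>Both sides are algebra homomorphisms agreeing on vectors, which generate the
  algebra.\<close>

lemma ext_map_comp:
  assumes "linear f" "linear g"
  shows "ext_map (f \<circ> g) x = ext_map f (ext_map g x)"
proof -
  have "linear (f \<circ> g)" using assms by (intro linear_compose)
  then show ?thesis
    by (induction x rule: ext_induct)
      (simp_all add: assms ext_map_one ext_map_mult ext_map_\<iota>
        linear_add[OF linear_ext_map] linear_scale[OF linear_ext_map])
qed

theorem proposition9:
  fixes A :: "real^4^4"
  assumes "invertible A"
  shows "\<forall>X :: real^4.
      det A *\<^sub>R point_rep (A *v X) = ext_map (ext2_map ((*v) A)) (point_rep X) \<and>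
      det (transpose (matrix_inv A)) *\<^sub>R plane_rep (transpose (matrix_inv A) *v X)
        = ext_map (J \<circ> ext2_map ((*v) (transpose (matrix_inv A))) \<circ> J) (plane_rep X)"
proof (intro allI conjI)
  fix X :: "real^4"
  show "det A *\<^sub>R point_rep (A *v X) = ext_map (ext2_map ((*v) A)) (point_rep X)"
    by (rule ext_map_point_rep[symmetric])
  define B where "B = transpose (matrix_inv A)"
  \<comment> \<open>Writing \<open>plane_rep X\<close> as \<open>ext_map J (point_rep X)\<close>
    puts a second \<open>J\<close> next to the inner one, and the two cancel.\<close>
  have "J \<circ> ext2_map ((*v) B) \<circ> J \<circ> J = J \<circ> ext2_map ((*v) B)"
    by (simp add: J_def fun_eq_iff)
  then have "ext_map (J \<circ> ext2_map ((*v) B) \<circ> J) (plane_rep X)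
      = ext_map (J \<circ> ext2_map ((*v) B)) (point_rep X)"
    by (simp add: linear_J linear_ext2_map linear_compose flip: ext_map_J_point_rep ext_map_comp)
  also have "\<dots> = ext_map J (det B *\<^sub>R point_rep (B *v X))"
    by (simp add: ext_map_comp linear_J linear_ext2_map ext_map_point_rep)
  also have "\<dots> = det B *\<^sub>R plane_rep (B *v X)"
    by (simp add: linear_scale[OF linear_ext_map[OF linear_J]] ext_map_J_point_rep)
  finally show "det B *\<^sub>R plane_rep (B *v X)
      = ext_map (J \<circ> ext2_map ((*v) B) \<circ> J) (plane_rep X)" ..
qed

end
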